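(* Let $\gamma_c>0$ and let $P:\mathbb{R}\to\mathbb{R}$ be a price schedule. (a) For any integer $K\ge 2$, $P$ is admissible for $K$ dealers if and only if $P$ is strictly convex. (b) $P$ is admissible for $K=1$ dealer if and only if the function $n\mapsto \frac{\gamma_c}{2}n^2+P(n)$ is strictly convex on $\mathbb{R}$ and satisfies $\lim_{n\to\pm\infty}\left(\gamma_c n+P'(n)\right)=\pm\infty$.
   Context: A price schedule is a continuous function $P:\mathbb{R}\to\mathbb{R}$ with $P(0)=0$ that is twice continuously differentiable on $\mathbb{R}\setminus\{0\}$. Fix $\gamma_c>0$ (the client's inventory cost). For an integer $K\ge 1$, a price schedule $P$, a type $y\in\mathbb{R}$ and $\mathbf{n}=(n_1,\dots,n_K)\in\mathbb{R}^K$, the client's goal function when all $K$ dealers quote $P$ is $$J_c^P(y;\mathbf{n})=y\sum_{k=1}^K n_k-\sum_{k=1}^K P(n_k)-\frac{\gamma_c}{2}\Big(\sum_{k=1}^K n_k\Big)^2 .$$ $P$ is called admissible for $K$ dealers if for every $y\in\mathbb{R}$ the function $\mathbf{n}\mapsto J_c^P(y;\mathbf{n})$ has a unique maximizer over $\mathbb{R}^K$ (by symmetry this maximizer then has the form $(n^P(y),\dots,n^P(y))$). *)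

theory Defs
  imports "HOL-Analysis.Analysis"
begin

definition price_schedule :: "(real \<Rightarrow> real) \<Rightarrow> bool" where
  "price_schedule P \<longleftrightarrow>
     continuous_on UNIV P \<and> P 0 = 0 \<and>
     P differentiable_on (- {0}) \<and>
     deriv P differentiable_on (- {0}) \<and>
     continuous_on (- {0}) (deriv (deriv P))"

definition strictly_convex_on :: "'a::real_vector set \<Rightarrow> ('a \<Rightarrow> real) \<Rightarrow> bool" where
  "strictly_convex_on S f \<longleftrightarrow>
     convex S \<and>
     (\<forall>x\<in>S. \<forall>y\<in>S. x \<noteq> y \<longrightarrow>
        (\<forall>t. 0 < t \<and> t < 1 \<longrightarrow>
           f ((1 - t) *\<^sub>R x + t *\<^sub>R y) < (1 - t) * f x + t * f y))"

definition client_goal ::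
  "real \<Rightarrow> nat \<Rightarrow> (real \<Rightarrow> real) \<Rightarrow> real \<Rightarrow> (nat \<Rightarrow> real) \<Rightarrow> real" where
  "client_goal \<gamma>\<^sub>c K P y n =
     y * (\<Sum>k=1..K. n k) - (\<Sum>k=1..K. P (n k)) - \<gamma>\<^sub>c / 2 * (\<Sum>k=1..K. n k)\<^sup>2"

text \<open>
  Since the number \<open>K\<close> of dealers varies, the space \<open>\<real>\<^sup>K\<close> is represented by the extensional
  functions on \<open>{1..K}\<close>. Extensionality is essential for uniqueness: arbitrary functions
  \<open>nat \<Rightarrow> real\<close> could differ outside \<open>{1..K}\<close> without changing the objective.
\<close>

definition admissible :: "real \<Rightarrow> nat \<Rightarrow> (real \<Rightarrow> real) \<Rightarrow> bool" where
  "admissible \<gamma>\<^sub>c K P \<longleftrightarrow>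
     (\<forall>y. \<exists>!n. is_arg_max (client_goal \<gamma>\<^sub>c K P y) (\<lambda>n. n \<in> {1..K} \<rightarrow>\<^sub>E UNIV) n)"

end

theory Submission
  imports Defs
begin

text \<open>
  Restricted to the diagonal, the objective is \<open>K\<close> times \<open>y * m - g m\<close> with
  \<open>g m = K * \<gamma> / 2 * m\<^sup>2 + P m\<close>, and by symmetry a unique maximizer is diagonal. The maximizer
  \<open>N y\<close> is monotone in \<open>y\<close>, unbounded in both directions, and continuous because its graph is
  closed; hence every \<open>m\<close> is the strict maximizer for some \<open>y\<close>. For \<open>K = 1\<close> this says that \<open>g\<close> has a
  strict supporting line at every point, whose slope is \<open>g'\<close>. For \<open>K \<ge> 2\<close>, moving two coordinates
  in opposite directions keeps the total fixed, so strict maximality at the diagonal point \<open>m\<close> gives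
  \<open>P (m + t) + P (m - t) > 2 * P m\<close>, which with continuity is strict convexity. Conversely, convexity
  of \<open>P\<close> reduces the maximization to the diagonal, where it is a coercive problem on the line.
\<close>

section \<open>Strict convexity and midpoints\<close>

lemma strictly_convex_on_imp_midpoint:
  fixes f :: "real \<Rightarrow> real"
  assumes "strictly_convex_on UNIV f" "x \<noteq> y"
  shows "f ((x + y) / 2) < (f x + f y) / 2"
proof -
  have "f ((1 - 1/2) *\<^sub>R x + (1/2) *\<^sub>R y) < (1 - 1/2) * f x + (1/2) * f y"
    using assms(1)[unfolded strictly_convex_on_def, THEN conjunct2, rule_format, of x y "1/2"]
      assms(2) by simp
  then show ?thesis by (simp add: field_simps)
qed

text \<open>The gap between \<open>f\<close> and its chord is continuous, hence attains a maximum on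
  the segment. Only the endpoints can be maximizers, and there the gap is 0.\<close>

lemma strictly_convex_onI_midpoint:
  fixes f :: "real \<Rightarrow> real"
  assumes cont: "continuous_on UNIV f"
    and mid: "\<And>x y. x \<noteq> y \<Longrightarrow> f ((x + y) / 2) < (f x + f y) / 2"
  shows "strictly_convex_on UNIV f"
  unfolding strictly_convex_on_def
proof (intro conjI ballI impI allI)
  fix x y t :: real
  assume "x \<noteq> y" and t: "0 < t \<and> t < 1"
  define F where "F s = f ((1 - s) * x + s * y)" for s
  define h where "h s = F s - ((1 - s) * f x + s * f y)" for s
  have h01: "h 0 = 0" "h 1 = 0" by (simp_all add: h_def F_def)
  have "continuous_on {0..1} h"
    unfolding h_def F_def by (intro continuous_intros continuous_on_compose2[OF cont]) auto
  then obtain c where c: "c \<in> {0..1}" and cmax: "\<And>s. s \<in> {0..1} \<Longrightarrow> h s \<le> h c"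
    using continuous_attains_sup[of "{0..1}" h] by auto
  text \<open>An interior maximizer of the gap \<open>h\<close> would contradict strict midpoint convexity.\<close>
  have no_interior_max: False
    if "0 < s" "s < 1" and smax: "\<And>r. r \<in> {0..1} \<Longrightarrow> h r \<le> h s" for s
  proof -
    \<comment> \<open>The largest symmetric step around \<open>s\<close> that stays inside
      \<open>{0..1}\<close>.\<close>
    define d where "d = min s (1 - s)"
    have d: "d > 0" "s - d \<in> {0..1}" "s + d \<in> {0..1}" using that by (auto simp: d_def)
    have "(1 - (s - d)) * x + (s - d) * y \<noteq> (1 - (s + d)) * x + (s + d) * y"
      using \<open>x \<noteq> y\<close> d(1) by (simp add: algebra_simps)
    moreover have "((1 - (s - d)) * x + (s - d) * y + ((1 - (s + d)) * x + (s + d) * y)) / 2 =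
        (1 - s) * x + s * y"
      by (simp add: field_simps)
    ultimately have "F s < (F (s - d) + F (s + d)) / 2"
      unfolding F_def using mid by metis
    then have "2 * h s < h (s - d) + h (s + d)"
      unfolding h_def by (simp add: algebra_simps)
    then show False using smax[OF d(2)] smax[OF d(3)] by linarith
  qed
  have "h c = 0" using no_interior_max[of c] c cmax h01 by force
  \<comment> \<open>The maximum of \<open>h\<close> is 0, so \<open>h t = 0\<close> would make
    \<open>t\<close> an interior maximizer.\<close>
  then have "h t < 0" using no_interior_max[of t] cmax t
    by (smt (verit) atLeastAtMost_iff)
  then show "f ((1 - t) *\<^sub>R x + t *\<^sub>R y) < (1 - t) * f x + t * f y"
    by (simp add: h_def F_def)
qed simp

lemma strictly_convex_on_imp_convex_on:
  assumes "strictly_convex_on S f"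
  shows "convex_on S f"
proof (rule convex_onI)
  fix t x y assume "0 < t" "t < (1::real)" "x \<in> S" "y \<in> S"
  then show "f ((1 - t) *\<^sub>R x + t *\<^sub>R y) \<le> (1 - t) * f x + t * f y"
    using assms unfolding strictly_convex_on_def
    by (cases "x = y") (auto simp: less_imp_le algebra_simps simp flip: scaleR_left.add)
qed (use assms in \<open>simp add: strictly_convex_on_def\<close>)

section \<open>Optimization on the real line\<close>

text \<open>If \<open>N\<close> stayed below \<open>n\<close>, a steep enough slope would make the
  move to \<open>n + 1\<close> profitable: its gain grows with the slope, while its cost is bounded
  because \<open>f\<close> is bounded below on \<open>{N 0..n}\<close>.\<close>

lemma linear_tilt_maximizer_ge:
  fixes f N :: "real \<Rightarrow> real"
  assumes cont: "continuous_on UNIV f"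
    and N: "\<And>y m. y * m - f m \<le> y * N y - f (N y)"
    and mono: "mono N"
  obtains b where "n \<le> N b"
proof (rule ccontr)
  assume "\<not> thesis"
  then have less: "N b < n" for b using that by (meson not_le)
  have "continuous_on {N 0..n} f" using cont continuous_on_subset by blast
  then obtain z where z: "\<And>m. m \<in> {N 0..n} \<Longrightarrow> f z \<le> f m"
    using continuous_attains_inf[of "{N 0..n}" f] less[of 0] by force
  \<comment> \<open>Positive, so that \<open>N 0\<close> \<le> \<open>N b\<close>, and larger than
    the greatest possible cost \<open>f (n + 1) - f z\<close> of a move of length at least
    1.\<close>
  define b where "b = max 0 (f (n + 1) - f z) + 1"
  have "b > 0" by (simp add: b_def)
  have "f z \<le> f (N b)"
    using z less[of b] monoD[OF mono, of 0 b] \<open>b > 0\<close> by simp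
  moreover have "b * (n + 1 - N b) \<le> f (n + 1) - f (N b)"
    using N[of b "n + 1"] by (simp add: algebra_simps)
  moreover have "b * 1 \<le> b * (n + 1 - N b)"
    using less[of b] \<open>b > 0\<close> by (intro mult_left_mono) auto
  ultimately show False by (simp add: b_def)
qed

text \<open>Adding the optimality inequalities for two slopes cancels \<open>f\<close>.\<close>

lemma linear_tilt_maximizer_mono:
  fixes f N :: "real \<Rightarrow> real"
  assumes N: "\<And>y m. y * m - f m \<le> y * N y - f (N y)"
  shows "mono N"
proof (rule monoI)
  fix y z :: real assume "y \<le> z"
  have "(z - y) * (N z - N y) \<ge> 0"
    using N[of y "N z"] N[of z "N y"] by (simp add: algebra_simps)
  then show "N y \<le> N z"
    using \<open>y \<le> z\<close> by (cases "y = z") (auto simp: zero_le_mult_iff)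
qed

text \<open>\<open>N\<close> is monotone and unbounded both ways; uniqueness of the maximizers makes
  it continuous, and the intermediate value theorem applies.\<close>

lemma linear_tilt_maximizer_surj:
  fixes f N :: "real \<Rightarrow> real"
  assumes cont: "continuous_on UNIV f"
    and N: "\<And>y m. m \<noteq> N y \<Longrightarrow> y * m - f m < y * N y - f (N y)"
  obtains y where "N y = n"
proof -
  have Nle: "y * m - f m \<le> y * N y - f (N y)" for y m
    using N[of m y] by (cases "m = N y") auto
  have mono: "mono N" by (rule linear_tilt_maximizer_mono[OF Nle])
  obtain b where b: "n \<le> N b" using linear_tilt_maximizer_ge[OF cont Nle mono] .
  obtain a where a: "N a \<le> n"
  proof -
    \<comment> \<open>Reflecting the line turns the upper bound already obtained into the lower
      one.\<close>
    have "continuous_on UNIV (\<lambda>x. f (- x))"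
      by (intro continuous_on_compose2[OF cont] continuous_intros) auto
    moreover have "y * m - f (- m) \<le> y * (- N (- y)) - f (- (- N (- y)))" for y m
      using Nle[of "- y" "- m"] by simp
    moreover have "mono (\<lambda>y. - N (- y))" using mono by (auto simp: mono_def)
    ultimately obtain c where "- n \<le> - N (- c)"
      by (rule linear_tilt_maximizer_ge[where f = "\<lambda>x. f (- x)"])
    then show ?thesis using that by simp
  qed
  show ?thesis
  proof (cases "a \<le> b")
    case False
    then have "N b \<le> N a" using mono by (simp add: monoD)
    then show ?thesis using a b that by (metis antisym order_trans)
  next
    case True
    \<comment> \<open>Optimality is a family of closed conditions on the pair, and strictness leaves
      \<open>N y\<close> as the only solution over \<open>y\<close>. A closed graph with compact
      range gives continuity.\<close>
    have graph: "(\<lambda>y. (y, N y)) ` {a..b} =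
        {a..b} \<times> {N a..N b} \<inter> (\<Inter>m. {p. fst p * m - f m \<le> fst p * snd p - f (snd p)})"
    proof (intro subset_antisym subsetI)
      fix p assume "p \<in> {a..b} \<times> {N a..N b} \<inter>
        (\<Inter>m. {p. fst p * m - f m \<le> fst p * snd p - f (snd p)})"
      then obtain y x where p: "p = (y, x)" "y \<in> {a..b}"
        and "\<And>m. y * m - f m \<le> y * x - f x" by (cases p) auto
      then have "x = N y" using N[of x y] by (meson not_le)
      then show "p \<in> (\<lambda>y. (y, N y)) ` {a..b}" using p by auto
    qed (use mono Nle in \<open>auto dest: monoD\<close>)
    have "closed ((\<lambda>y. (y, N y)) ` {a..b})"
      unfolding graph
      by (intro closed_Int closed_INT closed_Times closed_Collect_le ballI continuous_intros
          continuous_on_compose2[OF cont]) auto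
    moreover have "N \<in> {a..b} \<rightarrow> {N a..N b}" by (simp add: Pi_iff monoD[OF mono])
    ultimately have "continuous_on {a..b} N"
      by (intro continuous_from_closed_graph[OF compact_Icc])
    from IVT'[OF a b True this] show ?thesis using that by blast
  qed
qed

text \<open>The minimum over \<open>{a..b}\<close> is global by \<open>out\<close>; a second
  minimizer would be undercut by the midpoint of the two.\<close>

lemma continuous_strict_midpoint_attains_strict_inf:
  fixes h :: "real \<Rightarrow> real"
  assumes cont: "continuous_on UNIV h" and "a \<le> b"
    and out: "\<And>n. n \<notin> {a..b} \<Longrightarrow> \<exists>k\<in>{a..b}. h k \<le> h n"
    and mid: "\<And>x y. x \<noteq> y \<Longrightarrow> h ((x + y) / 2) < (h x + h y) / 2"
  obtains x where "\<And>m. m \<noteq> x \<Longrightarrow> h x < h m"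
proof -
  have "continuous_on {a..b} h" using cont continuous_on_subset by blast
  then obtain x where x: "\<And>m. m \<in> {a..b} \<Longrightarrow> h x \<le> h m"
    using continuous_attains_inf[of "{a..b}" h] \<open>a \<le> b\<close>
    by (metis atLeastatMost_empty_iff2 compact_Icc not_le order_trans linorder_not_less)
  then have min: "h x \<le> h m" for m
    by (meson out x order_trans)
  show ?thesis
  proof (rule that)
    fix m assume "m \<noteq> x"
    then show "h x < h m" using mid[of x m] min[of m] min[of "(x + m) / 2"] by (cases "h x = h m") auto
  qed
qed

section \<open>The objective, its symmetry and the diagonal\<close>

lemma sum_fun_upd2:
  fixes g :: "'b \<Rightarrow> 'c::ab_group_add"
  assumes "finite A" "i \<in> A" "j \<in> A" "i \<noteq> j"
  shows "(\<Sum>k\<in>A. g ((n(i := a, j := b)) k)) = (\<Sum>k\<in>A. g (n k)) - g (n i) - g (n j) + g a + g b"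
proof -
  have split: "sum u A = u i + u j + sum u (A - {i} - {j})" for u :: "'a \<Rightarrow> 'c"
    using assms by (simp add: sum.remove[of A i] sum.remove[of "A - {i}" j] add.assoc)
  have "(\<Sum>k\<in>A - {i} - {j}. g ((n(i := a, j := b)) k)) = (\<Sum>k\<in>A - {i} - {j}. g (n k))"
    by (rule sum.cong) auto
  then show ?thesis using assms(4) unfolding split[of "\<lambda>k. g (n k)"] split[of "\<lambda>k. g ((n(i := a, j := b)) k)"] by simp
qed

text \<open>The total is preserved, so only the prices of the two coordinates change. This covers
  swapping, spreading and averaging two quotes.\<close>

lemma client_goal_fun_upd2:
  assumes "i \<in> {1..K}" "j \<in> {1..K}" "i \<noteq> j" "a + b = n i + n j"
  shows "client_goal \<gamma> K P y (n(i := a, j := b)) =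
    client_goal \<gamma> K P y n + P (n i) + P (n j) - P a - P b"
proof -
  have "(\<Sum>k=1..K. (n(i := a, j := b)) k) = (\<Sum>k=1..K. n k)"
    using sum_fun_upd2[of "{1..K}" i j "\<lambda>x. x" n a b] assms by simp
  moreover have "(\<Sum>k=1..K. P ((n(i := a, j := b)) k)) =
      (\<Sum>k=1..K. P (n k)) - P (n i) - P (n j) + P a + P b"
    using assms by (intro sum_fun_upd2) auto
  ultimately show ?thesis unfolding client_goal_def by simp
qed

lemma client_goal_const:
  "client_goal \<gamma> K P y (restrict (\<lambda>_. m) {1..K}) = K * (y * m - (K * \<gamma> / 2 * m\<^sup>2 + P m))"
  by (simp add: client_goal_def algebra_simps power2_eq_square)

text \<open>In a linear order, a competitor that is not strictly worse than a maximizer is itself a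
  maximizer.\<close>

lemma ex1_is_arg_max_iff:
  fixes f :: "'a \<Rightarrow> 'b::linorder"
  shows "(\<exists>!n. is_arg_max f Q n) \<longleftrightarrow> (\<exists>n. Q n \<and> (\<forall>n'. Q n' \<longrightarrow> n' \<noteq> n \<longrightarrow> f n' < f n))"
proof
  assume "\<exists>!n. is_arg_max f Q n"
  then obtain n where n: "is_arg_max f Q n" and uniq: "\<And>n'. is_arg_max f Q n' \<Longrightarrow> n' = n"
    by blast
  have "f n' < f n" if "Q n'" "n' \<noteq> n" for n'
  proof (rule ccontr)
    assume "\<not> f n' < f n"
    then have "is_arg_max f Q n'"
      using n that(1) unfolding is_arg_max_linorder by (meson not_less order_trans)
    then show False using uniq that(2) by blast
  qed
  then show "\<exists>n. Q n \<and> (\<forall>n'. Q n' \<longrightarrow> n' \<noteq> n \<longrightarrow> f n' < f n)"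
    using n unfolding is_arg_max_def by blast
next
  assume "\<exists>n. Q n \<and> (\<forall>n'. Q n' \<longrightarrow> n' \<noteq> n \<longrightarrow> f n' < f n)"
  then obtain n where n: "Q n" "\<And>n'. Q n' \<Longrightarrow> n' \<noteq> n \<Longrightarrow> f n' < f n" by blast
  show "\<exists>!n. is_arg_max f Q n"
  proof (rule ex1I[of _ n])
    show "is_arg_max f Q n"
      using n unfolding is_arg_max_linorder by (metis less_imp_le order_refl)
    show "n' = n" if "is_arg_max f Q n'" for n'
      using n that unfolding is_arg_max_def by blast
  qed
qed

lemma admissible_iff_strict_max:
  "admissible \<gamma> K P \<longleftrightarrow> (\<forall>y. \<exists>n \<in> {1..K} \<rightarrow>\<^sub>E UNIV. \<forall>n' \<in> {1..K} \<rightarrow>\<^sub>E UNIV.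
     n' \<noteq> n \<longrightarrow> client_goal \<gamma> K P y n' < client_goal \<gamma> K P y n)"
  unfolding admissible_def ex1_is_arg_max_iff Bex_def Ball_def ..

lemma PiE_const_eq_restrict:
  assumes "n \<in> A \<rightarrow>\<^sub>E B" "\<And>i. i \<in> A \<Longrightarrow> n i = m"
  shows "n = restrict (\<lambda>_. m) A"
  using assms by (auto simp: PiE_def extensional_def fun_eq_iff)

lemma restrict_const_eq_iff:
  fixes K :: nat
  assumes "K \<ge> 1"
  shows "restrict (\<lambda>_. m) {1..K} = restrict (\<lambda>_. m') {1..K} \<longleftrightarrow> m = m'"
proof
  assume "restrict (\<lambda>_. m) {1..K} = restrict (\<lambda>_. m') {1..K}"
  from fun_cong[OF this, of 1] show "m = m'" using assms by simp
qed simp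

text \<open>Swapping two coordinates leaves the objective unchanged, so uniqueness forces the
  maximizer onto the diagonal.\<close>
lemma admissible_imp_diagonal:
  assumes "admissible \<gamma> K P" "K \<ge> 1"
  shows "\<exists>m. \<forall>n \<in> {1..K} \<rightarrow>\<^sub>E UNIV. n \<noteq> restrict (\<lambda>_. m) {1..K} \<longrightarrow>
    client_goal \<gamma> K P y n < client_goal \<gamma> K P y (restrict (\<lambda>_. m) {1..K})"
proof -
  obtain n where n: "n \<in> {1..K} \<rightarrow>\<^sub>E UNIV" and max: "\<And>n'. n' \<in> {1..K} \<rightarrow>\<^sub>E UNIV \<Longrightarrow> n' \<noteq> n \<Longrightarrow>
     client_goal \<gamma> K P y n' < client_goal \<gamma> K P y n"
    using assms(1)[unfolded admissible_iff_strict_max, rule_format, of y] by blast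
  have "n i = n 1" if "i \<in> {1..K}" for i
  proof (rule ccontr)
    assume ne: "n i \<noteq> n 1"
    define n' where "n' = n(i := n 1, 1 := n i)"
    have "client_goal \<gamma> K P y n' = client_goal \<gamma> K P y n"
      unfolding n'_def using that assms(2) ne by (subst client_goal_fun_upd2) auto
    moreover have "n' \<in> {1..K} \<rightarrow>\<^sub>E UNIV"
      using n that assms(2) by (auto simp: n'_def PiE_def extensional_def)
    moreover have "n' \<noteq> n" using ne by (auto simp: n'_def fun_eq_iff)
    ultimately show False using max[of n'] by simp
  qed
  then have eq: "n = restrict (\<lambda>_. n 1) {1..K}"
    by (rule PiE_const_eq_restrict[OF n])
  show ?thesis
    by (rule exI[of _ "n 1"], fold eq) (blast intro: max)
qed

text \<open>The diagonal maximizers for all \<open>y\<close> solve a linearly tilted problem on the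
  line, so every \<open>m\<close> occurs among them. Strictness against off-diagonal points is
  retained for later perturbations.\<close>

lemma admissible_imp_diagonal_surj:
  assumes "admissible \<gamma> K P" "K \<ge> 1" "continuous_on UNIV P"
  shows "\<exists>y. \<forall>n \<in> {1..K} \<rightarrow>\<^sub>E UNIV. n \<noteq> restrict (\<lambda>_. m) {1..K} \<longrightarrow>
    client_goal \<gamma> K P y n < client_goal \<gamma> K P y (restrict (\<lambda>_. m) {1..K})"
proof -
  have "\<exists>N. \<forall>y. \<forall>n \<in> {1..K} \<rightarrow>\<^sub>E UNIV. n \<noteq> restrict (\<lambda>_. N y) {1..K} \<longrightarrow>
      client_goal \<gamma> K P y n < client_goal \<gamma> K P y (restrict (\<lambda>_. N y) {1..K})"
    by (rule choice) (intro allI admissible_imp_diagonal assms)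
  then obtain N where N: "\<forall>y. \<forall>n \<in> {1..K} \<rightarrow>\<^sub>E UNIV. n \<noteq> restrict (\<lambda>_. N y) {1..K} \<longrightarrow>
      client_goal \<gamma> K P y n < client_goal \<gamma> K P y (restrict (\<lambda>_. N y) {1..K})"
    ..
  define g where "g m = K * \<gamma> / 2 * m\<^sup>2 + P m" for m
  have "continuous_on UNIV g"
    unfolding g_def by (intro continuous_intros assms(3))
  moreover have "y * m - g m < y * N y - g (N y)" if "m \<noteq> N y" for y m
    using N[rule_format, of "restrict (\<lambda>_. m) {1..K}" y] that assms(2)
    unfolding client_goal_const restrict_const_eq_iff[OF assms(2)] g_def by simp
  ultimately obtain y where "N y = m" by (rule linear_tilt_maximizer_surj)
  with N[THEN spec, of y] show ?thesis by (intro exI[of _ y]) simp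
qed

text \<open>An off-diagonal point need only lose to some diagonal point, since the diagonal optimum
  is at least as good as that one.\<close>

lemma admissibleI:
  assumes "K \<ge> 1"
    and diag: "\<And>y. \<exists>x. \<forall>m. m \<noteq> x \<longrightarrow> (K * \<gamma> / 2 * x\<^sup>2 + P x) - y * x < (K * \<gamma> / 2 * m\<^sup>2 + P m) - y * m"
    and off: "\<And>y n i j. n \<in> {1..K} \<rightarrow>\<^sub>E UNIV \<Longrightarrow> i \<in> {1..K} \<Longrightarrow> j \<in> {1..K} \<Longrightarrow> n i \<noteq> n j \<Longrightarrow>
      \<exists>m. client_goal \<gamma> K P y n < client_goal \<gamma> K P y (restrict (\<lambda>_. m) {1..K})"
  shows "admissible \<gamma> K P"
  unfolding admissible_iff_strict_max
proof
  fix y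
  let ?d = "\<lambda>m. restrict (\<lambda>_. m) {1..K}"
  obtain x where x: "\<And>m. m \<noteq> x \<Longrightarrow>
      (K * \<gamma> / 2 * x\<^sup>2 + P x) - y * x < (K * \<gamma> / 2 * m\<^sup>2 + P m) - y * m"
    using diag by blast
  have lt: "client_goal \<gamma> K P y (?d m) < client_goal \<gamma> K P y (?d x)" if "m \<noteq> x" for m
    using x[OF that] assms(1) unfolding client_goal_const by simp
  have "client_goal \<gamma> K P y n < client_goal \<gamma> K P y (?d x)"
    if n: "n \<in> {1..K} \<rightarrow>\<^sub>E UNIV" "n \<noteq> ?d x" for n
  proof (cases "\<exists>i\<in>{1..K}. \<exists>j\<in>{1..K}. n i \<noteq> n j")
    case True
    then obtain m where "client_goal \<gamma> K P y n < client_goal \<gamma> K P y (?d m)"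
      using off[OF n(1)] by blast
    then show ?thesis using lt[of m] by (cases "m = x") auto
  next
    case False
    then have "n i = n 1" if "i \<in> {1..K}" for i
      using that assms(1) by (meson atLeastAtMost_iff order_refl)
    then have "n = ?d (n 1)"
      by (rule PiE_const_eq_restrict[OF n(1)])
    then obtain m where m: "n = ?d m" ..
    then have "m \<noteq> x" using n(2) by auto
    with lt[of m] show ?thesis by (simp add: m)
  qed
  then show "\<exists>n \<in> {1..K} \<rightarrow>\<^sub>E UNIV. \<forall>n' \<in> {1..K} \<rightarrow>\<^sub>E UNIV.
     n' \<noteq> n \<longrightarrow> client_goal \<gamma> K P y n' < client_goal \<gamma> K P y n"
    by (intro bexI[of _ "?d x"]) auto
qed

section \<open>Several dealers\<close>

text \<open>With two coordinates available, the optimal diagonal point at \<open>m\<close> can be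
  spread to \<open>u\<close> and \<open>v\<close> without changing the total; its strict loss is the
  midpoint inequality.\<close>

lemma admissible_imp_strictly_convex:
  assumes "admissible \<gamma> K P" "K \<ge> 2" and cont: "continuous_on UNIV P"
  shows "strictly_convex_on UNIV P"
proof (rule strictly_convex_onI_midpoint[OF cont])
  fix u v :: real assume "u \<noteq> v"
  define m where "m = (u + v) / 2"
  define d where "d = restrict (\<lambda>_. m) {1..K}"
  have d: "d 1 = m" "d 2 = m" using assms(2) by (auto simp: d_def)
  obtain y where y: "\<And>n. n \<in> {1..K} \<rightarrow>\<^sub>E UNIV \<Longrightarrow> n \<noteq> d \<Longrightarrow>
      client_goal \<gamma> K P y n < client_goal \<gamma> K P y d"
    using admissible_imp_diagonal_surj[OF assms(1) _ cont, of m] assms(2) unfolding d_def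
    by auto
  have "d(1 := u, 2 := v) \<in> {1..K} \<rightarrow>\<^sub>E UNIV"
    using assms(2) by (auto simp: d_def PiE_def extensional_def)
  moreover have "d(1 := u, 2 := v) \<noteq> d"
  proof
    assume "d(1 := u, 2 := v) = d"
    from fun_cong[OF this, of 1] fun_cong[OF this, of 2] show False
      using \<open>u \<noteq> v\<close> d by simp
  qed
  ultimately have "client_goal \<gamma> K P y (d(1 := u, 2 := v)) < client_goal \<gamma> K P y d"
    by (rule y)
  moreover have "client_goal \<gamma> K P y (d(1 := u, 2 := v)) =
      client_goal \<gamma> K P y d + P (d 1) + P (d 2) - P u - P v"
    using assms(2) d by (intro client_goal_fun_upd2) (auto simp: m_def)
  ultimately show "P ((u + v) / 2) < (P u + P v) / 2"
    unfolding d m_def by simp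
qed

text \<open>Jensen's inequality with equal weights; the other terms depend only on the
  total.\<close>

lemma client_goal_le_mean:
  assumes "convex_on UNIV P" "K \<ge> 1"
  shows "client_goal \<gamma> K P y n \<le>
    client_goal \<gamma> K P y (restrict (\<lambda>_. (\<Sum>k=1..K. n k) / K) {1..K})"
proof -
  have "P (\<Sum>k=1..K. (1 / K) *\<^sub>R n k) \<le> (\<Sum>k=1..K. 1 / K * P (n k))"
    using assms by (intro convex_on_sum) auto
  then have "K * P ((\<Sum>k=1..K. n k) / K) \<le> (\<Sum>k=1..K. P (n k))"
    using assms(2) by (simp add: field_simps flip: sum_divide_distrib)
  then show ?thesis
    using assms(2) unfolding client_goal_def by simp
qed

lemma square_midpoint_le: "((x + y) / 2)\<^sup>2 \<le> (x\<^sup>2 + y\<^sup>2) / (2::real)"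
proof -
  have "(x\<^sup>2 + y\<^sup>2) / 2 - ((x + y) / 2)\<^sup>2 = ((x - y) / 2)\<^sup>2"
    by (simp add: power2_eq_square field_simps)
  then show ?thesis using zero_le_power2[of "(x - y) / 2"] by linarith
qed

text \<open>The diagonal problem is coercive and strictly midpoint convex. Off the diagonal,
  averaging two unequal coordinates is a strict improvement.\<close>

lemma strictly_convex_imp_admissible:
  assumes "\<gamma> > 0" "K \<ge> 1" and cont: "continuous_on UNIV P" and "P 0 = 0"
    and sc: "strictly_convex_on UNIV P"
  shows "admissible \<gamma> K P"
proof (rule admissibleI[OF assms(2)])
  note mid = strictly_convex_on_imp_midpoint[OF sc]
  note conv = strictly_convex_on_imp_convex_on[OF sc]
  fix y
  define c where "c = K * \<gamma> / 2"
  have "c > 0" using assms by (simp add: c_def)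
  define h where "h m = (c * m\<^sup>2 + P m) - y * m" for m
  \<comment> \<open>Beyond this radius the quadratic term outweighs the linear lower bounds on
    \<open>P\<close> from its values at 1 and -1.\<close>
  define r where "r = max 1 (max ((y - P 1) / c) ((- y - P (- 1)) / c))"
  have r: "r \<ge> 1" "c * r \<ge> y - P 1" "c * r \<ge> - y - P (- 1)"
  proof -
    have "(y - P 1) / c \<le> r" "(- y - P (- 1)) / c \<le> r" by (simp_all add: r_def)
    then show "c * r \<ge> y - P 1" "c * r \<ge> - y - P (- 1)"
      using \<open>c > 0\<close> by (simp_all add: pos_divide_le_eq mult.commute)
  qed (simp add: r_def)
  text \<open>Convexity and \<open>P 0 = 0\<close> give \<open>P (s * e) \<ge> s * P e\<close> for \<open>s \<ge> 1\<close>, a linear lower bound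
    that the quadratic term beats.\<close>
  have scale: "s * P e \<le> P (s * e)" if "s \<ge> 1" for s e
  proof -
    have "P ((1 - 1 / s) *\<^sub>R 0 + (1 / s) *\<^sub>R (s * e)) \<le> (1 - 1 / s) * P 0 + 1 / s * P (s * e)"
      using that by (intro convex_onD[OF conv]) auto
    then show ?thesis using that \<open>P 0 = 0\<close> by (simp add: field_simps)
  qed
  have out: "\<exists>k\<in>{- r..r}. h k \<le> h m" if m: "m \<notin> {- r..r}" for m
  proof (rule bexI[of _ 0])
    consider "m > r" | "m < - r" using m by (meson atLeastAtMost_iff not_le)
    then have "0 \<le> h m"
    proof cases
      case 1
      have "c * r \<le> c * m" using 1 \<open>c > 0\<close> by simp
      \<comment> \<open>By \<open>scale\<close>, this product is a lower bound for
        \<open>h m\<close>.\<close>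
      then have "0 \<le> m * (c * m + P 1 - y)" using 1 r by (intro mult_nonneg_nonneg) linarith+
      then show ?thesis using scale[of m 1] 1 r
        by (simp add: h_def power2_eq_square algebra_simps)
    next
      case 2
      have "c * r \<le> c * (- m)" using 2 \<open>c > 0\<close> by (intro mult_left_mono) auto
      then have "0 \<le> (- m) * (c * (- m) + P (- 1) + y)"
        using 2 r by (intro mult_nonneg_nonneg) linarith+
      then show ?thesis using scale[of "- m" "- 1"] 2 r
        by (simp add: h_def power2_eq_square algebra_simps)
    qed
    then show "h 0 \<le> h m" using \<open>P 0 = 0\<close> by (simp add: h_def)
  qed (use r in auto)
  have "continuous_on UNIV h" unfolding h_def by (intro continuous_intros cont)
  moreover have "h ((u + v) / 2) < (h u + h v) / 2" if "u \<noteq> v" for u v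
    using mid[OF that] mult_left_mono[OF square_midpoint_le[of u v], of c] \<open>c > 0\<close>
    by (simp add: h_def field_simps)
  ultimately obtain x where "\<And>m. m \<noteq> x \<Longrightarrow> h x < h m"
    using continuous_strict_midpoint_attains_strict_inf[of h "- r" r] out r by auto
  then show "\<exists>x. \<forall>m. m \<noteq> x \<longrightarrow>
      (K * \<gamma> / 2 * x\<^sup>2 + P x) - y * x < (K * \<gamma> / 2 * m\<^sup>2 + P m) - y * m"
    unfolding h_def c_def by blast
next
  fix y n i j
  assume ij: "i \<in> {1..K}" "j \<in> {1..K}" "n i \<noteq> (n j :: real)"
  define a where "a = (n i + n j) / 2"
  define n' where "n' = n(i := a, j := a)"
  have "client_goal \<gamma> K P y n' = client_goal \<gamma> K P y n + P (n i) + P (n j) - P a - P a"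
    unfolding n'_def using ij by (intro client_goal_fun_upd2) (auto simp: a_def)
  then have "client_goal \<gamma> K P y n < client_goal \<gamma> K P y n'"
    using strictly_convex_on_imp_midpoint[OF sc ij(3)] by (simp add: a_def)
  \<comment> \<open>The point \<open>n'\<close> may still be off the diagonal; passing to the mean
    of all its coordinates costs nothing.\<close>
  also note client_goal_le_mean[OF strictly_convex_on_imp_convex_on[OF sc] assms(2)]
  finally show "\<exists>m. client_goal \<gamma> K P y n < client_goal \<gamma> K P y (restrict (\<lambda>_. m) {1..K})"
    by blast
qed

section \<open>A single dealer\<close>

text \<open>Forward, strict supporting lines give convexity, and maximizers for every slope give the
  limits. Backward, the limits make each tilt of \<open>f\<close> monotone on two outer rays, which
  leaves a compact problem.\<close>

lemma admissible_1_iff: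
  assumes cont: "continuous_on UNIV P" and diff: "P differentiable_on (- {0})"
  shows "admissible \<gamma> 1 P \<longleftrightarrow>
       strictly_convex_on UNIV (\<lambda>n. \<gamma> / 2 * n\<^sup>2 + P n) \<and>
       filterlim (\<lambda>n. \<gamma> * n + deriv P n) at_top at_top \<and>
       filterlim (\<lambda>n. \<gamma> * n + deriv P n) at_bot at_bot"
    (is "_ \<longleftrightarrow> ?sc \<and> ?top \<and> ?bot")
proof -
  define f where "f n = \<gamma> / 2 * n\<^sup>2 + P n" for n
  have fcont: "continuous_on UNIV f" unfolding f_def by (intro continuous_intros cont)
  have f_deriv: "((\<lambda>n. f n - y * n) has_real_derivative \<gamma> * n + deriv P n - y) (at n)"
    if "n \<noteq> 0" for n y
  proof -
    have "P differentiable at n"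
      using diff that differentiable_on_eq_differentiable_at[of "- {0}" P]
      by (simp add: open_Compl)
    then have "(P has_real_derivative deriv P n) (at n)"
      by (metis DERIV_deriv_iff_real_differentiable)
    then show ?thesis
      unfolding f_def by (auto intro!: derivative_eq_intros)
  qed
  show ?thesis
  proof (intro iffI conjI)
    assume adm: "admissible \<gamma> 1 P"
    have goal: "client_goal \<gamma> 1 P y (restrict (\<lambda>_. m) {1..1}) = y * m - f m" for y m
      unfolding client_goal_const by (simp add: f_def)
    have sub: "\<exists>y. \<forall>m. m \<noteq> n \<longrightarrow> y * m - f m < y * n - f n" for n
    proof -
      obtain y where y: "\<And>n'. n' \<in> {1..1} \<rightarrow>\<^sub>E UNIV \<Longrightarrow> n' \<noteq> restrict (\<lambda>_. n) {1..1} \<Longrightarrow>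
          client_goal \<gamma> 1 P y n' < client_goal \<gamma> 1 P y (restrict (\<lambda>_. n) {1..1})"
        using admissible_imp_diagonal_surj[OF adm order_refl cont, of n] by blast
      have "y * m - f m < y * n - f n" if "m \<noteq> n" for m
        using y[of "restrict (\<lambda>_. m) {1..1}"] that restrict_const_eq_iff[of 1 m n]
        unfolding goal by simp
      then show ?thesis by blast
    qed
    have ex: "\<exists>n. \<forall>m. y * m - f m \<le> y * n - f n" for y
    proof -
      obtain n where n: "\<And>n'. n' \<in> {1..1} \<rightarrow>\<^sub>E UNIV \<Longrightarrow> n' \<noteq> restrict (\<lambda>_. n) {1..1} \<Longrightarrow>
          client_goal \<gamma> 1 P y n' < client_goal \<gamma> 1 P y (restrict (\<lambda>_. n) {1..1})"
        using admissible_imp_diagonal[OF adm order_refl, of y] by blast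
      have "y * m - f m \<le> y * n - f n" for m
        using n[of "restrict (\<lambda>_. m) {1..1}"] restrict_const_eq_iff[of 1 m n]
        unfolding goal by (cases "m = n") auto
      then show ?thesis by blast
    qed
    \<comment> \<open>First-order condition; \<open>n = 0\<close> is excluded because
      \<open>P\<close> may have a kink there.\<close>
    have slope: "y = \<gamma> * n + deriv P n" if "n \<noteq> 0" "\<And>m. y * m - f m \<le> y * n - f n" for y n
    proof -
      have "\<forall>m. \<bar>n - m\<bar> < 1 \<longrightarrow> f n - y * n \<le> f m - y * m" using that(2) by (smt (verit))
      from DERIV_local_min[OF f_deriv[OF that(1)] _ this] show ?thesis by simp
    qed
    \<comment> \<open>Monotonicity of optimal slopes: the marginal cost at \<open>n\<close> lies on
      the same side of \<open>Z\<close> as \<open>n\<close> does of a maximizer \<open>x\<close> for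
      slope \<open>Z\<close>, up to equality.\<close>
    have compare: "(\<gamma> * n + deriv P n - Z) * (n - x) \<ge> 0"
      if "n \<noteq> 0" "\<And>m. Z * m - f m \<le> Z * x - f x" for n x Z
    proof -
      obtain y where y: "\<forall>m. m \<noteq> n \<longrightarrow> y * m - f m < y * n - f n" using sub by blast
      then have yle: "y * m - f m \<le> y * n - f n" for m by (cases "m = n") (auto simp: less_imp_le)
      have "(y - Z) * (n - x) \<ge> 0"
        using yle[of x] that(2)[of n] by (simp add: algebra_simps)
      then show ?thesis using slope[OF that(1) yle] by simp
    qed
    show "strictly_convex_on UNIV (\<lambda>n. \<gamma> / 2 * n\<^sup>2 + P n)"
      unfolding f_def[symmetric]
    proof (rule strictly_convex_onI_midpoint[OF fcont])
      fix u v :: real assume "u \<noteq> v"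
      \<comment> \<open>Averaging the supporting inequality at \<open>u\<close> and \<open>v\<close>
        cancels the slope.\<close>
      obtain y where y: "\<And>m. m \<noteq> (u + v) / 2 \<Longrightarrow>
          y * m - f m < y * ((u + v) / 2) - f ((u + v) / 2)"
        using sub by blast
      show "f ((u + v) / 2) < (f u + f v) / 2"
        using y[of u] y[of v] \<open>u \<noteq> v\<close> by (simp add: field_simps)
    qed
    show ?top
      unfolding filterlim_at_top
    proof
      fix Z
      obtain x where x: "\<And>m. Z * m - f m \<le> Z * x - f x" using ex by blast
      show "eventually (\<lambda>n. Z \<le> \<gamma> * n + deriv P n) at_top"
        using eventually_gt_at_top[of "max 0 x"]
      proof eventually_elim
        case (elim n)
        then show ?case using compare[OF _ x, of n] by (auto simp: zero_le_mult_iff)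
      qed
    qed
    show ?bot
      unfolding filterlim_at_bot
    proof
      fix Z
      obtain x where x: "\<And>m. Z * m - f m \<le> Z * x - f x" using ex by blast
      show "eventually (\<lambda>n. \<gamma> * n + deriv P n \<le> Z) at_bot"
        using eventually_gt_at_bot[of "min 0 x"]
      proof eventually_elim
        case (elim n)
        then show ?case using compare[OF _ x, of n] by (auto simp: zero_le_mult_iff)
      qed
    qed
  next
    assume asm: "?sc \<and> ?top \<and> ?bot"
    have mid: "f ((u + v) / 2) < (f u + f v) / 2" if "u \<noteq> v" for u v
      using strictly_convex_on_imp_midpoint[of f, OF _ that] asm unfolding f_def by blast
    show "admissible \<gamma> 1 P"
    proof (rule admissibleI)
      fix y
      define h where "h n = f n - y * n" for n
      obtain b0 where b0: "\<And>n. n \<ge> b0 \<Longrightarrow> y \<le> \<gamma> * n + deriv P n"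
        using asm unfolding filterlim_at_top eventually_at_top_linorder by blast
      obtain a0 where a0: "\<And>n. n \<le> a0 \<Longrightarrow> \<gamma> * n + deriv P n \<le> y"
        using asm unfolding filterlim_at_bot eventually_at_bot_linorder by blast
      \<comment> \<open>The thresholds are pushed past -1 and 1 so that both outer rays avoid the
        possible kink at 0.\<close>
      define a b where "a = min a0 (- 1)" and "b = max b0 1"
      have "h b \<le> h n" if "b \<le> n" for n
        using that
      proof (rule DERIV_nonneg_imp_nondecreasing)
        fix x assume "b \<le> x" "x \<le> n"
        then show "\<exists>z. (h has_real_derivative z) (at x) \<and> 0 \<le> z"
          using b0[of x] f_deriv[of x y] unfolding h_def b_def by force
      qed
      moreover have "h a \<le> h n" if "n \<le> a" for n
        using that
      proof (rule DERIV_nonpos_imp_nonincreasing)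
        fix x assume "n \<le> x" "x \<le> a"
        then show "\<exists>z. (h has_real_derivative z) (at x) \<and> z \<le> 0"
          using a0[of x] f_deriv[of x y] unfolding h_def a_def by force
      qed
      moreover have "a \<le> b" by (simp add: a_def b_def)
      ultimately have out: "\<exists>k\<in>{a..b}. h k \<le> h n" if "n \<notin> {a..b}" for n
        using that by (metis atLeastAtMost_iff linear order_refl)
      have "continuous_on UNIV h" unfolding h_def by (intro continuous_intros fcont)
      moreover have "h ((u + v) / 2) < (h u + h v) / 2" if "u \<noteq> v" for u v
        using mid[OF that] by (simp add: h_def field_simps)
      ultimately obtain x where "\<And>m. m \<noteq> x \<Longrightarrow> h x < h m"
        using continuous_strict_midpoint_attains_strict_inf[of h a b] out \<open>a \<le> b\<close> by blast
      then show "\<exists>x. \<forall>m. m \<noteq> x \<longrightarrow> (real 1 * \<gamma> / 2 * x\<^sup>2 + P x) - y * x <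
          (real 1 * \<gamma> / 2 * m\<^sup>2 + P m) - y * m"
        by (auto simp: h_def f_def)
    \<comment> \<open>With one dealer no two coordinates differ, so the off-diagonal condition is
      vacuous.\<close>
    qed auto
  qed
qed

theorem lemma2p5:
  fixes \<gamma>\<^sub>c :: real and P :: "real \<Rightarrow> real"
  assumes "\<gamma>\<^sub>c > 0" and "price_schedule P"
  shows "(\<forall>K\<ge>2. admissible \<gamma>\<^sub>c K P \<longleftrightarrow> strictly_convex_on UNIV P) \<and>
    (admissible \<gamma>\<^sub>c 1 P \<longleftrightarrow>
       strictly_convex_on UNIV (\<lambda>n. \<gamma>\<^sub>c / 2 * n\<^sup>2 + P n) \<and>
       filterlim (\<lambda>n. \<gamma>\<^sub>c * n + deriv P n) at_top at_top \<and>
       filterlim (\<lambda>n. \<gamma>\<^sub>c * n + deriv P n) at_bot at_bot)"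
proof -
  have P: "continuous_on UNIV P" "P 0 = 0" "P differentiable_on (- {0})"
    using assms(2) by (auto simp: price_schedule_def)
  have "admissible \<gamma>\<^sub>c K P \<longleftrightarrow> strictly_convex_on UNIV P" if "K \<ge> 2" for K
    using admissible_imp_strictly_convex[OF _ that P(1)]
      strictly_convex_imp_admissible[OF assms(1) _ P(1,2)] that by auto
  then show ?thesis using admissible_1_iff[OF P(1,3)] by blast
qed

end
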